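(* Let $\mathcal H$, $X$, $\Sigma$, $\widehat\Sigma$, $B$, $\epsilon$, $(\lambda_i)_{i\ge1}$, $(\widehat\lambda_i)_{i\ge1}$, $(q_i)_{i\ge1}$ be as in the context; in particular $\widehat\Sigma$ is any estimator of $\Sigma$ (not assumed non-negative) such that, with probability at least $1-\epsilon$, for every unit vector $u\in\mathcal H$, $$\bigl|\langle \Sigma u,u\rangle-\langle\widehat\Sigma u,u\rangle\bigr|\le B(\langle\Sigma u,u\rangle)\quad\text{and}\quad \bigl|\langle \Sigma u,u\rangle-\langle\widehat\Sigma u,u\rangle\bigr|\le B(\langle\widehat\Sigma u,u\rangle).$$ Define $\widetilde\lambda_i=\max\{\widehat\lambda_i-B(\widehat\lambda_i),0\}$ and $\widetilde\Sigma u=\sum_{i\ge1}\widetilde\lambda_i\langle u,q_i\rangle q_i$. Then, with probability at least $1-\epsilon$, for every $L>0$ and every $1/L$-Lipschitz function $f$, $$\| f(\Sigma) - f(\widetilde \Sigma) \|_{HS}\leq L^{-1} \| \Sigma-\widetilde \Sigma\|_{HS}\leq \min_{\tau \geq 1} L^{-1} \sqrt{13\, \tau B(\lambda_1)^2+ 2 \sum_{i=\tau+1}^{+\infty }\lambda_i^2},$$ where the minimum is over positive integers $\tau$ and $\lambda_1$ is the largest eigenvalue of $\Sigma$.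
   Context: $\mathcal H$ is a real separable Hilbert space with inner product $\langle\cdot,\cdot\rangle$, and $X$ is a random vector in $\mathcal H$ with covariance operator $\Sigma u=\mathbb E[\langle u,X-\mathbb E[X]\rangle (X-\mathbb E[X])]$, assumed to have finite trace. $\lambda_1\ge\lambda_2\ge\dots\ge0$ are the eigenvalues of $\Sigma$ and $(p_i)_{i\ge1}$ is a corresponding orthonormal basis of eigenvectors, so $\Sigma u=\sum_{i\ge1}\lambda_i\langle u,p_i\rangle p_i$. $\widehat\Sigma$ is an estimator of $\Sigma$: a random symmetric operator on $\mathcal H$, function of an i.i.d. sample, admitting an orthonormal basis of eigenvectors; it may have negative eigenvalues. $\widehat\Sigma_+$ is its positive part (same eigenvectors, each eigenvalue replaced by its positive part), $\widehat\lambda_1\ge\widehat\lambda_2\ge\dots\ge0$ are the eigenvalues of $\widehat\Sigma_+$, and $(q_i)_{i\ge1}$ is a corresponding orthonormal basis of eigenvectors of $\widehat\Sigma$, so $\widehat\Sigma_+u=\sum_{i\ge1}\widehat\lambda_i\langle u,q_i\rangle q_i$. (In finite dimension the sums are finite.) $B$ is a non-decreasing real-valued function of a real variable such that $B(t+a)\le B(t)+a/2$ for all $t$ and all $a\ge0$, and $\epsilon\in(0,1)$. A function $f:\mathbb R\to\mathbb R$ is $1/L$-Lipschitz if $|f(s)-f(t)|\le|s-t|/L$ for all $s,t$. $f(\Sigma)u=\sum_i f(\lambda_i)\langle u,p_i\rangle p_i$ and $f(\widetilde\Sigma)u=\sum_i f(\widetilde\lambda_i)\langle u,q_i\rangle q_i$.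 $\|T\|_{HS}=\mathbf{Tr}(T^*T)^{1/2}$ is the Hilbert–Schmidt (Frobenius) norm. *)

theory Defs
  imports "HOL-Probability.Probability"
begin

definition orthonormal_basis :: "'i set \<Rightarrow> ('i \<Rightarrow> 'h::real_inner) \<Rightarrow> bool" where
  "orthonormal_basis I e \<longleftrightarrow>
     (\<forall>i\<in>I. \<forall>j\<in>I. e i \<bullet> e j = (if i = j then 1 else 0)) \<and> closure (span (e ` I)) = UNIV"

text \<open>
  Bases of a separable space are numbered from 1, by \<open>{1..d}\<close> in finite dimension \<open>d\<close> and by all
  positive integers in infinite dimension. The zero space is left out: it has no first eigenvalue.
\<close>

definition basis_index :: "nat set \<Rightarrow> bool" where
  "basis_index I \<longleftrightarrow> I = {1..} \<or> (\<exists>d\<ge>1. I = {1..d})"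

definition eigenbasis :: "('h \<Rightarrow> 'h) \<Rightarrow> 'i set \<Rightarrow> ('i \<Rightarrow> real) \<Rightarrow> ('i \<Rightarrow> 'h::real_inner) \<Rightarrow> bool" where
  "eigenbasis T I \<mu> e \<longleftrightarrow> orthonormal_basis I e \<and> (\<forall>i\<in>I. T (e i) = \<mu> i *\<^sub>R e i)"

definition spectral_op :: "'i set \<Rightarrow> ('i \<Rightarrow> real) \<Rightarrow> ('i \<Rightarrow> 'h) \<Rightarrow> 'h::real_inner \<Rightarrow> 'h" where
  "spectral_op I c e u = (\<Sum>\<^sub>\<infinity>i\<in>I. (c i * (u \<bullet> e i)) *\<^sub>R e i)"

text \<open>
  Trace of a non-negative operator, with values in \<open>[0, \<infinity>]\<close>; for such operators the sum does not
  depend on the orthonormal basis. On other operators the definition is not meaningful, since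
  \<open>ennreal\<close> cuts off negative terms; it is only applied to covariance operators and to \<open>T\<^sup>*T\<close>.
\<close>

definition op_trace :: "('h \<Rightarrow> 'h::real_inner) \<Rightarrow> ennreal" where
  "op_trace T = (\<Sum>\<^sub>\<infinity>e\<in>(SOME E. orthonormal_basis E (\<lambda>e. e)). ennreal (T e \<bullet> e))"

text \<open>
  The Hilbert--Schmidt norm is \<open>\<infinity>\<close> for an operator that is not Hilbert--Schmidt, so a finite upper
  bound on it includes the assertion that the operator is Hilbert--Schmidt.
\<close>

definition hs_norm :: "('h \<Rightarrow> 'h::real_inner) \<Rightarrow> ennreal" where
  "hs_norm T =
     (let t = op_trace (adjoint T \<circ> T) in if t = \<infinity> then \<infinity> else ennreal (sqrt (enn2real t)))"

definition covariance_integrand ::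
    "'w measure \<Rightarrow> ('w \<Rightarrow> 'h) \<Rightarrow> 'h \<Rightarrow> 'w \<Rightarrow> 'h::{real_inner, banach, second_countable_topology}" where
  "covariance_integrand M X u \<omega> =
     (u \<bullet> (X \<omega> - integral\<^sup>L M X)) *\<^sub>R (X \<omega> - integral\<^sup>L M X)"

definition covariance_op ::
    "'w measure \<Rightarrow> ('w \<Rightarrow> 'h) \<Rightarrow> 'h \<Rightarrow> 'h::{real_inner, banach, second_countable_topology}" where
  "covariance_op M X u = integral\<^sup>L M (covariance_integrand M X u)"

text \<open>
  The Bochner integral is 0 on non-integrable functions, hence the two integrability conditions.
\<close>

definition has_finite_trace_covariance ::
    "'w measure \<Rightarrow> ('w \<Rightarrow> 'h::{real_inner, banach, second_countable_topology}) \<Rightarrow> bool" where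
  "has_finite_trace_covariance M X \<longleftrightarrow>
     integrable M X \<and> (\<forall>u. integrable M (covariance_integrand M X u)) \<and>
     op_trace (covariance_op M X) < \<infinity>"

definition iid_sample ::
    "'w measure \<Rightarrow> ('w \<Rightarrow> 'h::topological_space) \<Rightarrow> nat \<Rightarrow> (nat \<Rightarrow> 'w \<Rightarrow> 'h) \<Rightarrow> bool" where
  "iid_sample M X n Y \<longleftrightarrow>
     prob_space.indep_vars M (\<lambda>_. borel) Y {1..n} \<and>
     (\<forall>k\<in>{1..n}. distr M borel (Y k) = distr M borel X)"

text \<open>
  \<open>P\<close> holds with probability at least \<open>p\<close>. For a measurable \<open>P\<close> this is \<open>measure M {\<omega> \<in> space M. P \<omega>} \<ge> p\<close>;
  in general it asks for a measurable event of probability at least \<open>p\<close> on which \<open>P\<close> holds, because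
  properties quantified over all vectors or all functions need not be measurable.
\<close>

definition with_prob_at_least :: "'w measure \<Rightarrow> real \<Rightarrow> ('w \<Rightarrow> bool) \<Rightarrow> bool" where
  "with_prob_at_least M p P \<longleftrightarrow> (\<exists>A\<in>sets M. measure M A \<ge> p \<and> (\<forall>\<omega>\<in>A. P \<omega>))"

end

theory Submission
  imports Defs
begin

text \<open>
  Work on a sample point where both inequalities hold. For operators that are diagonal in the
  orthonormal bases \<open>p\<close> and \<open>q\<close>, the squared Hilbert--Schmidt norm of the difference is
  \<open>\<Sum>i k. (c i - d k)\<^sup>2 (q k \<bullet> p i)\<^sup>2\<close>; comparing terms gives the Lipschitz estimate.

  For the second estimate put \<open>b = B (lam 1)\<close>. By polarization \<open>\<Sigma> - \<Sigma>_hat\<close> has norm at most \<open>b\<close>,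
  and \<open>\<Sigma>_hat - \<Sigma>_til\<close>, which is diagonal in \<open>q\<close>, has norm at most \<open>3/2 b\<close>. Hence the
  terms of the double sum with \<open>i \<le> \<tau>\<close>, and likewise those with \<open>k \<le> \<tau>\<close>, contribute at most
  \<open>\<tau> (5/2 b)\<^sup>2\<close>, in total \<open>25/2 \<tau> b\<^sup>2 \<le> 13 \<tau> b\<^sup>2\<close>. In the remaining terms
  \<open>(lam i - lam_til k)\<^sup>2 \<le> (lam i)\<^sup>2 + (lam_til k)\<^sup>2\<close>, and the min-max principle gives
  \<open>lam_til k \<le> lam k\<close>, which leaves twice the tail of \<open>\<Sum>i. (lam i)\<^sup>2\<close>.
\<close>

section \<open>Infinite sums in the extended non-negative reals\<close>

lemma infsum_ennreal_add:
  fixes f g :: "'a \<Rightarrow> ennreal"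
  shows "(\<Sum>\<^sub>\<infinity>x\<in>A. f x + g x) = infsum f A + infsum g A"
  by (intro infsum_add nonneg_summable_on_complete) simp_all

lemma infsum_ennreal_mono:
  fixes f g :: "'a \<Rightarrow> ennreal"
  assumes "\<And>x. x \<in> A \<Longrightarrow> f x \<le> g x"
  shows "infsum f A \<le> infsum g A"
  using assms by (intro infsum_mono nonneg_summable_on_complete) simp_all

lemma infsum_ennreal_cmult:
  fixes f :: "'a \<Rightarrow> ennreal"
  shows "(\<Sum>\<^sub>\<infinity>x\<in>A. ennreal c * f x) = ennreal c * infsum f A"
  by (simp add: nonneg_infsum_complete SUP_mult_left_ennreal[symmetric] sum_distrib_left[symmetric])

lemma sum_le_infsum_ennreal:
  fixes f :: "'a \<Rightarrow> ennreal"
  assumes "finite F" "F \<subseteq> A"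
  shows "sum f F \<le> infsum f A"
  using assms by (auto simp: nonneg_infsum_complete intro!: SUP_upper)

lemma infsum_ennreal_sum:
  fixes f :: "'a \<Rightarrow> 'b \<Rightarrow> ennreal"
  assumes "finite F"
  shows "(\<Sum>x\<in>F. \<Sum>\<^sub>\<infinity>y\<in>B. f x y) = (\<Sum>\<^sub>\<infinity>y\<in>B. \<Sum>x\<in>F. f x y)"
  using assms by induction (simp_all add: infsum_ennreal_add)

text \<open>By symmetry one inequality suffices: a finite sum over \<open>x\<close> may be exchanged
  with the sum over \<open>y\<close>, and it is then at most the full sum over \<open>x\<close>. The
  bound is proved for arbitrary index types so that it can be used in both directions.\<close>

lemma infsum_ennreal_swap:
  fixes f :: "'a \<Rightarrow> 'b \<Rightarrow> ennreal"
  shows "(\<Sum>\<^sub>\<infinity>x\<in>A. \<Sum>\<^sub>\<infinity>y\<in>B. f x y) = (\<Sum>\<^sub>\<infinity>y\<in>B. \<Sum>\<^sub>\<infinity>x\<in>A. f x y)"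
proof -
  have le: "(\<Sum>\<^sub>\<infinity>x\<in>A. \<Sum>\<^sub>\<infinity>y\<in>B. f x y) \<le> (\<Sum>\<^sub>\<infinity>y\<in>B. \<Sum>\<^sub>\<infinity>x\<in>A. f x y)"
    for A :: "'c set" and B :: "'d set" and f :: "'c \<Rightarrow> 'd \<Rightarrow> ennreal"
    by (rule infsum_le_finite_sums)
      (auto simp: infsum_ennreal_sum nonneg_summable_on_complete intro!: infsum_ennreal_mono sum_le_infsum_ennreal)
  show ?thesis by (intro antisym le)
qed

text \<open>Both sides are suprema of the same finite partial sums. This carries convergent real
  series, such as those from Parseval, into \<open>ennreal\<close>, where sums can be exchanged
  freely.\<close>

lemma infsum_ennreal_eq:
  fixes f :: "'a \<Rightarrow> real"
  assumes "(f has_sum s) A" "\<And>x. x \<in> A \<Longrightarrow> 0 \<le> f x"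
  shows "(\<Sum>\<^sub>\<infinity>x\<in>A. ennreal (f x)) = ennreal s"
proof -
  have "ennreal s = (SUP F\<in>{F. finite F \<and> F \<subseteq> A}. ennreal (sum f F))"
    using infsum_nonneg_is_SUPREMUM_ennreal[of f A] assms by (simp add: has_sum_iff)
  also have "\<dots> = (\<Sum>\<^sub>\<infinity>x\<in>A. ennreal (f x))"
    using assms(2) by (auto simp: nonneg_infsum_complete subset_iff intro!: SUP_cong sum_ennreal[symmetric])
  finally show ?thesis by simp
qed

text \<open>A finite value in \<open>ennreal\<close> is a common real bound for all finite partial
  sums.\<close>

lemma summable_on_of_infsum_ennreal:
  fixes f :: "'a \<Rightarrow> real"
  assumes "(\<Sum>\<^sub>\<infinity>x\<in>A. ennreal (f x)) < \<infinity>" "\<And>x. x \<in> A \<Longrightarrow> 0 \<le> f x"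
  shows "f summable_on A"
proof (rule nonneg_bdd_above_summable_on)
  obtain s where s: "(\<Sum>\<^sub>\<infinity>x\<in>A. ennreal (f x)) = ennreal s" "0 \<le> s"
    using assms(1) by (cases "\<Sum>\<^sub>\<infinity>x\<in>A. ennreal (f x)") auto
  show "bdd_above (sum f ` {F. F \<subseteq> A \<and> finite F})"
  proof (rule bdd_aboveI2)
    fix F assume F: "F \<in> {F. F \<subseteq> A \<and> finite F}"
    then have "ennreal (sum f F) = (\<Sum>x\<in>F. ennreal (f x))"
      using assms(2) by (intro sum_ennreal[symmetric]) auto
    also have "\<dots> \<le> ennreal s" using F s sum_le_infsum_ennreal[of F A] by (metis (no_types, lifting) mem_Collect_eq)
    finally show "sum f F \<le> s" using s by (simp add: ennreal_le_iff)
  qed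
qed (use assms in auto)

section \<open>Orthonormal bases\<close>

text \<open>By Pythagoras, the squared norm of a block of the vector series is a block of the series
  of squared norms. The finite partial sums therefore form a Cauchy net, and completeness gives the
  limit.\<close>

lemma orthogonal_summable_on:
  fixes f :: "'i \<Rightarrow> 'h::{real_inner, banach}"
  assumes orth: "\<And>i j. i \<in> A \<Longrightarrow> j \<in> A \<Longrightarrow> i \<noteq> j \<Longrightarrow> f i \<bullet> f j = 0"
    and summ: "(\<lambda>i. (norm (f i))\<^sup>2) summable_on A"
  shows "f summable_on A"
proof -
  have "cauchy_filter (filtermap (sum f) (finite_subsets_at_top A))"
    unfolding cauchy_filter_metric_filtermap
  proof (intro allI impI)
    fix e :: real assume "0 < e"
    define s where "s = (\<Sum>\<^sub>\<infinity>i\<in>A. (norm (f i))\<^sup>2)"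
    have s: "((\<lambda>i. (norm (f i))\<^sup>2) has_sum s) A" using summ by (simp add: s_def)
    \<comment> \<open>Beyond \<open>F0\<close> the squared norms add up to at most
      \<open>(e/3)\<^sup>2\<close>, so two partial sums over sets containing \<open>F0\<close>
      differ by at most \<open>2 * e / 3\<close>.\<close>
    obtain F0 where F0: "finite F0" "F0 \<subseteq> A" "dist (\<Sum>i\<in>F0. (norm (f i))\<^sup>2) s \<le> (e/3)\<^sup>2"
      using has_sum_finite_approximation[OF s, of "(e/3)\<^sup>2"] \<open>0 < e\<close> by auto
    have near: "dist (sum f F) (sum f F0) \<le> e/3" if F: "finite F" "F0 \<subseteq> F" "F \<subseteq> A" for F
    proof -
      have "(norm (sum f (F - F0)))\<^sup>2 = (\<Sum>i\<in>F - F0. (norm (f i))\<^sup>2)"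
        using F by (intro norm_sum_Pythagorean) (auto simp: pairwise_def orthogonal_def intro!: orth)
      also have "\<dots> = (\<Sum>i\<in>F. (norm (f i))\<^sup>2) - (\<Sum>i\<in>F0. (norm (f i))\<^sup>2)"
        using F by (intro sum_diff) auto
      also have "\<dots> \<le> s - (\<Sum>i\<in>F0. (norm (f i))\<^sup>2)"
        using finite_sum_le_has_sum[OF s F(1,3)] by simp
      also have "\<dots> \<le> (e/3)\<^sup>2" using F0(3) by (simp add: dist_real_def)
      finally have "norm (sum f (F - F0)) \<le> e/3"
        using \<open>0 < e\<close> by (simp add: power2_le_iff_abs_le)
      then show ?thesis using F by (simp add: dist_norm sum_diff)
    qed
    have "dist (sum f F) (sum f G) < e"
      if "finite F" "F0 \<subseteq> F" "F \<subseteq> A" "finite G" "F0 \<subseteq> G" "G \<subseteq> A" for F G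
      using near[of F] near[of G] that \<open>0 < e\<close> dist_triangle2[of "sum f F" "sum f G" "sum f F0"] by linarith
    then show "\<exists>P. eventually P (finite_subsets_at_top A) \<and> (\<forall>F G. P F \<and> P G \<longrightarrow> dist (sum f F) (sum f G) < e)"
      using F0 by (intro exI[of _ "\<lambda>F. finite F \<and> F0 \<subseteq> F \<and> F \<subseteq> A"])
        (auto simp: eventually_finite_subsets_at_top)
  qed
  then obtain x where "filtermap (sum f) (finite_subsets_at_top A) \<le> nhds x"
    using cauchy_filter_complete_converges[of "filtermap (sum f) (finite_subsets_at_top A)" UNIV]
    by (auto simp: filtermap_bot_iff complete_UNIV)
  then show ?thesis by (auto simp: summable_on_def has_sum_def filterlim_def)
qed

lemma orthonormal_basisD:
  assumes "orthonormal_basis I e" "i \<in> I" "j \<in> I"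
  shows "e i \<bullet> e j = (if i = j then 1 else 0)"
  using assms by (simp add: orthonormal_basis_def)

lemma orthonormal_basis_norm:
  assumes "orthonormal_basis I e" "i \<in> I"
  shows "norm (e i) = 1"
  using orthonormal_basisD[OF assms assms(2)] by (simp add: norm_eq_1)

lemma orthonormal_basis_inj_on:
  assumes "orthonormal_basis I e"
  shows "inj_on e I"
  using orthonormal_basisD[OF assms] by (metis inj_onI zero_neq_one)

text \<open>Bases are brought into the form from which \<open>op_trace\<close> selects by
  \<open>SOME\<close>: a set of vectors indexed by itself. This shows that the choice ranges over a
  nonempty family.\<close>

lemma orthonormal_basis_range:
  assumes "orthonormal_basis I e"
  shows "orthonormal_basis (e ` I) (\<lambda>x. x)"
  using assms orthonormal_basis_inj_on[OF assms] unfolding orthonormal_basis_def by (auto simp: inj_on_eq_iff)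

lemma Bessel_identity:
  assumes "orthonormal_basis I e" "finite F" "F \<subseteq> I"
  shows "(norm (u - (\<Sum>i\<in>F. (u \<bullet> e i) *\<^sub>R e i)))\<^sup>2 = (norm u)\<^sup>2 - (\<Sum>i\<in>F. (u \<bullet> e i)\<^sup>2)"
proof -
  have "(\<Sum>i\<in>F. (u \<bullet> e i) *\<^sub>R e i) \<bullet> e j = u \<bullet> e j" if "j \<in> F" for j
  proof -
    have "(\<Sum>i\<in>F. (u \<bullet> e i) *\<^sub>R e i) \<bullet> e j = (\<Sum>i\<in>F. if i = j then u \<bullet> e j else 0)"
      unfolding inner_sum_left using assms that by (intro sum.cong) (auto simp: orthonormal_basisD subset_iff)
    then show ?thesis using that assms by simp
  qed
  then have "(\<Sum>i\<in>F. (u \<bullet> e i) *\<^sub>R e i) \<bullet> (\<Sum>i\<in>F. (u \<bullet> e i) *\<^sub>R e i) = (\<Sum>i\<in>F. (u \<bullet> e i)\<^sup>2)"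
    by (subst inner_sum_right) (simp add: power2_eq_square)
  moreover have "u \<bullet> (\<Sum>i\<in>F. (u \<bullet> e i) *\<^sub>R e i) = (\<Sum>i\<in>F. (u \<bullet> e i)\<^sup>2)"
    by (simp add: inner_sum_right power2_eq_square)
  ultimately show ?thesis
    by (simp add: power2_norm_eq_inner inner_diff_left inner_diff_right inner_commute)
qed

text \<open>Bessel's inequality gives one direction. For the other, \<open>u\<close> is approximated
  by a finite combination \<open>s\<close> of basis vectors, and the orthogonal projection of
  \<open>u\<close> onto those vectors is at least as close to \<open>u\<close> as
  \<open>s\<close>.\<close>

lemma Parseval_norm:
  assumes ob: "orthonormal_basis I e"
  shows "((\<lambda>i. (u \<bullet> e i)\<^sup>2) has_sum (norm u)\<^sup>2) I"
proof -
  have le: "(\<Sum>i\<in>F. (u \<bullet> e i)\<^sup>2) \<le> (norm u)\<^sup>2" if "finite F" "F \<subseteq> I" for F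
    using Bessel_identity[OF ob that, of u] by (smt (verit) zero_le_power2)
  have summ: "(\<lambda>i. (u \<bullet> e i)\<^sup>2) summable_on I"
    by (rule nonneg_bdd_above_summable_on) (auto intro!: bdd_aboveI2 le)
  have "(norm u)\<^sup>2 \<le> (\<Sum>\<^sub>\<infinity>i\<in>I. (u \<bullet> e i)\<^sup>2)"
  proof (rule field_le_epsilon)
    fix r :: real assume "0 < r"
    have "u \<in> closure (span (e ` I))" using ob by (simp add: orthonormal_basis_def)
    then obtain s where s: "s \<in> span (e ` I)" "dist s u < sqrt r"
      using \<open>0 < r\<close> unfolding closure_approachable by (meson real_sqrt_gt_zero)
    from s(1) obtain T a where T: "finite T" "T \<subseteq> e ` I" "s = (\<Sum>v\<in>T. a v *\<^sub>R v)"
      unfolding span_explicit by auto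
    obtain F where F: "F \<subseteq> I" "finite F" "T = e ` F"
      using T by (meson finite_subset_image)
    have "inj_on e F" using orthonormal_basis_inj_on[OF ob] F(1) by (rule inj_on_subset)
    then have sF: "s = (\<Sum>i\<in>F. a (e i) *\<^sub>R e i)" using T F by (simp add: sum.reindex)
    define w where "w = u - (\<Sum>i\<in>F. (u \<bullet> e i) *\<^sub>R e i)"
    have Fs: "(\<Sum>i\<in>F. (s \<bullet> e i) *\<^sub>R e i) = s"
    proof -
      have "s \<bullet> e j = a (e j)" if "j \<in> F" for j
      proof -
        have "s \<bullet> e j = (\<Sum>i\<in>F. if i = j then a (e j) else 0)"
          unfolding sF inner_sum_left using ob F that
          by (intro sum.cong) (auto simp: orthonormal_basisD subset_iff)
        then show ?thesis using that F by simp
      qed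
      then show ?thesis using sF by simp
    qed
    \<comment> \<open>The projection fixes \<open>s\<close>, so \<open>u\<close> and
      \<open>u - s\<close> leave the same residual \<open>w\<close>, whose norm is at most that of
      \<open>u - s\<close>.\<close>
    have "(u - s) - (\<Sum>i\<in>F. ((u - s) \<bullet> e i) *\<^sub>R e i) = w"
      by (simp add: w_def inner_diff_left scaleR_diff_left sum_subtractf Fs)
    then have "(norm w)\<^sup>2 = (norm (u - s))\<^sup>2 - (\<Sum>i\<in>F. ((u - s) \<bullet> e i)\<^sup>2)"
      using Bessel_identity[OF ob F(2,1), of "u - s"] by simp
    also have "\<dots> \<le> (norm (u - s))\<^sup>2" by (simp add: sum_nonneg)
    also have "\<dots> \<le> r"
    proof -
      have "(dist s u)\<^sup>2 \<le> (sqrt r)\<^sup>2" using s by (intro power_mono) auto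
      then show ?thesis using \<open>0 < r\<close> by (simp add: dist_norm norm_minus_commute)
    qed
    finally have "(norm u)\<^sup>2 - (\<Sum>i\<in>F. (u \<bullet> e i)\<^sup>2) \<le> r"
      using Bessel_identity[OF ob F(2,1), of u] by (simp add: w_def)
    moreover have "(\<Sum>i\<in>F. (u \<bullet> e i)\<^sup>2) \<le> (\<Sum>\<^sub>\<infinity>i\<in>I. (u \<bullet> e i)\<^sup>2)"
      using summ F by (intro finite_sum_le_infsum) auto
    ultimately show "(norm u)\<^sup>2 \<le> (\<Sum>\<^sub>\<infinity>i\<in>I. (u \<bullet> e i)\<^sup>2) + r" by simp
  qed
  moreover have "(\<Sum>\<^sub>\<infinity>i\<in>I. (u \<bullet> e i)\<^sup>2) \<le> (norm u)\<^sup>2"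
    by (rule infsum_le_finite_sums[OF summ le])
  ultimately show ?thesis using summ by (simp add: has_sum_iff)
qed

text \<open>Polarization of the norm identity.\<close>

lemma Parseval:
  assumes ob: "orthonormal_basis I e"
  shows "((\<lambda>i. (u \<bullet> e i) * (v \<bullet> e i)) has_sum (u \<bullet> v)) I"
proof -
  have "((\<lambda>i. 1/4 * (((u + v) \<bullet> e i)\<^sup>2 + - ((u - v) \<bullet> e i)\<^sup>2))
      has_sum 1/4 * ((norm (u + v))\<^sup>2 + - (norm (u - v))\<^sup>2)) I"
    by (intro has_sum_cmult_right has_sum_add has_sum_uminusI Parseval_norm[OF ob])
  moreover have "1/4 * ((norm (u + v))\<^sup>2 + - (norm (u - v))\<^sup>2) = u \<bullet> v"
    by (simp add: power2_norm_eq_inner inner_add_left inner_add_right inner_diff_left inner_diff_right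
        inner_commute)
  moreover have "1/4 * (((u + v) \<bullet> e i)\<^sup>2 + - ((u - v) \<bullet> e i)\<^sup>2) = (u \<bullet> e i) * (v \<bullet> e i)" for i
    by (simp add: inner_add_left inner_diff_left power2_eq_square algebra_simps)
  ultimately show ?thesis by (simp only:)
qed

lemma infsum_Parseval:
  assumes "orthonormal_basis I e"
  shows "(\<Sum>\<^sub>\<infinity>i\<in>I. ennreal ((u \<bullet> e i)\<^sup>2)) = ennreal ((norm u)\<^sup>2)"
  using assms by (intro infsum_ennreal_eq Parseval_norm) auto

lemma orthonormal_basis_eqI:
  assumes ob: "orthonormal_basis I e" and eq: "\<And>i. i \<in> I \<Longrightarrow> u \<bullet> e i = v \<bullet> e i"
  shows "u = v"
proof -
  have "((\<lambda>i. ((u - v) \<bullet> e i)\<^sup>2) has_sum 0) I"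
    using eq by (intro has_sum_0) (simp add: inner_diff_left)
  from has_sum_unique[OF this Parseval_norm[OF ob, of "u - v"]] show ?thesis by simp
qed

section \<open>Diagonal operators and the Hilbert--Schmidt norm\<close>

text \<open>This weak form fixes every coefficient of \<open>T u\<close>, and hence \<open>T\<close>
  on the whole space; the eigenvector equations alone would fix a linear operator only on the span
  of the basis.\<close>

definition diagonal_in :: "'i set \<Rightarrow> ('i \<Rightarrow> 'h::real_inner) \<Rightarrow> ('i \<Rightarrow> real) \<Rightarrow> ('h \<Rightarrow> 'h) \<Rightarrow> bool" where
  "diagonal_in I e c T \<longleftrightarrow> orthonormal_basis I e \<and> (\<forall>u. \<forall>i\<in>I. T u \<bullet> e i = c i * (u \<bullet> e i))"

lemma diagonal_inD:
  assumes "diagonal_in I e c T"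
  shows "orthonormal_basis I e" and "i \<in> I \<Longrightarrow> T u \<bullet> e i = c i * (u \<bullet> e i)"
  using assms by (auto simp: diagonal_in_def)

text \<open>Symmetry moves \<open>T\<close> onto the eigenvector.\<close>

lemma eigenbasis_diagonal_in:
  assumes "eigenbasis T I c e" "\<And>u v. T u \<bullet> v = u \<bullet> T v"
  shows "diagonal_in I e c T"
  using assms by (simp add: eigenbasis_def diagonal_in_def)

text \<open>Bounded coefficients make the series square-summable with orthogonal terms, so it
  converges and inner products can be taken term by term. Convergence has to be shown because
  \<open>infsum\<close> is 0 by default on a divergent family.\<close>

lemma spectral_op_diagonal_in:
  fixes e :: "'i \<Rightarrow> 'h::{real_inner, banach}"
  assumes ob: "orthonormal_basis I e" and C: "\<And>i. i \<in> I \<Longrightarrow> \<bar>c i\<bar> \<le> C"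
  shows "diagonal_in I e c (spectral_op I c e)"
proof -
  have "spectral_op I c e u \<bullet> e k = c k * (u \<bullet> e k)" if k: "k \<in> I" for u k
  proof -
    let ?f = "\<lambda>i. (c i * (u \<bullet> e i)) *\<^sub>R e i"
    have le: "(norm (?f i))\<^sup>2 \<le> C\<^sup>2 * (u \<bullet> e i)\<^sup>2" if "i \<in> I" for i
    proof -
      have "(c i)\<^sup>2 \<le> C\<^sup>2" using C[OF that] by (simp add: abs_le_square_iff[symmetric])
      then show ?thesis using that ob by (simp add: orthonormal_basis_norm power_mult_distrib mult_right_mono)
    qed
    have "(\<lambda>i. C\<^sup>2 * (u \<bullet> e i)\<^sup>2) summable_on I"
      using Parseval_norm[OF ob, of u] by (intro summable_on_cmult_right) (auto simp: has_sum_iff)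
    then have "(\<lambda>i. (norm (?f i))\<^sup>2) summable_on I"
      using le by (rule summable_on_comparison_test) (blast intro: zero_le_power2)+
    then have "?f summable_on I"
      by (rule orthogonal_summable_on[rotated]) (simp add: orthonormal_basisD[OF ob])
    then have "(?f has_sum spectral_op I c e u) I" by (simp add: spectral_op_def)
    then have "((\<lambda>i. ?f i \<bullet> e k) has_sum (spectral_op I c e u \<bullet> e k)) I"
      by (rule has_sum_bounded_linear[OF bounded_linear_inner_left, unfolded o_def])
    moreover have "((\<lambda>i. ?f i \<bullet> e k) has_sum (c k * (u \<bullet> e k))) I"
      using k by (intro has_sum_finite_neutralI[of "{k}"]) (auto simp: orthonormal_basisD[OF ob])
    ultimately show ?thesis by (rule has_sum_unique)
  qed
  then show ?thesis using ob by (simp add: diagonal_in_def)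
qed

lemma diagonal_in_inner:
  assumes "diagonal_in I e c T"
  shows "((\<lambda>i. c i * ((u \<bullet> e i) * (v \<bullet> e i))) has_sum (T u \<bullet> v)) I"
  using Parseval[OF diagonal_inD(1)[OF assms], of "T u" v] diagonal_inD(2)[OF assms]
  by (simp add: mult.assoc cong: has_sum_cong)

lemma diagonal_in_symmetric:
  assumes "diagonal_in I e c T"
  shows "T u \<bullet> v = u \<bullet> T v"
proof -
  have "((\<lambda>i. c i * ((u \<bullet> e i) * (v \<bullet> e i))) has_sum (u \<bullet> T v)) I"
    using diagonal_in_inner[OF assms, of v u] by (simp only: mult.commute[of "v \<bullet> _"] inner_commute[of _ u])
  with diagonal_in_inner[OF assms] show ?thesis by (rule has_sum_unique)
qed

lemma diagonal_in_quadratic: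
  assumes "diagonal_in I e c T"
  shows "((\<lambda>i. c i * (u \<bullet> e i)\<^sup>2) has_sum (T u \<bullet> u)) I"
  using diagonal_in_inner[OF assms, of u u] by (simp add: power2_eq_square)

lemma diagonal_in_eigenvector:
  assumes T: "diagonal_in I e c T" and i: "i \<in> I"
  shows "T (e i) = c i *\<^sub>R e i"
  using i by (intro orthonormal_basis_eqI[OF diagonal_inD(1)[OF T]])
    (auto simp: diagonal_inD(2)[OF T] orthonormal_basisD[OF diagonal_inD(1)[OF T]])

lemma diagonal_in_linear:
  assumes T: "diagonal_in I e c T"
  shows "linear T"
  by (intro linearI orthonormal_basis_eqI[OF diagonal_inD(1)[OF T]])
    (auto simp: diagonal_inD(2)[OF T] inner_add_left algebra_simps)

lemma diagonal_in_diff: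
  assumes "diagonal_in I e c T" "diagonal_in I e d S"
  shows "diagonal_in I e (\<lambda>i. c i - d i) (\<lambda>u. T u - S u)"
  using assms by (simp add: diagonal_in_def inner_diff_left left_diff_distrib)

lemma diagonal_in_norm_le:
  assumes T: "diagonal_in I e c T" and C: "\<And>i. i \<in> I \<Longrightarrow> \<bar>c i\<bar> \<le> C" "0 \<le> C"
  shows "norm (T u) \<le> C * norm u"
proof -
  have "(norm (T u))\<^sup>2 \<le> C\<^sup>2 * (norm u)\<^sup>2"
  proof (rule has_sum_mono[OF Parseval_norm has_sum_cmult_right[OF Parseval_norm]])
    show "(T u \<bullet> e i)\<^sup>2 \<le> C\<^sup>2 * (u \<bullet> e i)\<^sup>2" if "i \<in> I" for i
    proof -
      have "(c i)\<^sup>2 \<le> C\<^sup>2" using C(1)[OF that] by (simp add: abs_le_square_iff[symmetric])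
      then show ?thesis using that by (simp add: diagonal_inD(2)[OF T] power_mult_distrib mult_right_mono)
    qed
  qed (rule diagonal_inD(1)[OF T])+
  then have "(norm (T u))\<^sup>2 \<le> (C * norm u)\<^sup>2" by (simp add: power_mult_distrib)
  then show ?thesis by (rule power2_le_imp_le) (use C in simp)
qed

text \<open>The quadratic form at a unit vector is an average of the \<open>c i\<close> with weights
  \<open>(u \<bullet> e i)\<^sup>2\<close>. Only indices of positive weight count, which allows for
  vectors orthogonal to part of the basis. The lower bound below has the same reason.\<close>

lemma diagonal_in_quadratic_le:
  assumes T: "diagonal_in I e c T" and C: "\<And>i. i \<in> I \<Longrightarrow> u \<bullet> e i \<noteq> 0 \<Longrightarrow> c i \<le> C"
  shows "T u \<bullet> u \<le> C * (norm u)\<^sup>2"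
proof (rule has_sum_mono[OF diagonal_in_quadratic[OF T] has_sum_cmult_right[OF Parseval_norm]])
  show "c i * (u \<bullet> e i)\<^sup>2 \<le> C * (u \<bullet> e i)\<^sup>2" if "i \<in> I" for i
    using C[OF that] by (cases "u \<bullet> e i = 0") (auto intro: mult_right_mono)
qed (rule diagonal_inD(1)[OF T])

lemma diagonal_in_quadratic_ge:
  assumes T: "diagonal_in I e c T" and C: "\<And>i. i \<in> I \<Longrightarrow> u \<bullet> e i \<noteq> 0 \<Longrightarrow> C \<le> c i"
  shows "C * (norm u)\<^sup>2 \<le> T u \<bullet> u"
proof (rule has_sum_mono[OF has_sum_cmult_right[OF Parseval_norm] diagonal_in_quadratic[OF T]])
  show "C * (u \<bullet> e i)\<^sup>2 \<le> c i * (u \<bullet> e i)\<^sup>2" if "i \<in> I" for i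
    using C[OF that] by (cases "u \<bullet> e i = 0") (auto intro: mult_right_mono)
qed (rule diagonal_inD(1)[OF T])

text \<open>Polarization expresses \<open>D u \<bullet> v\<close> by the quadratic form at
  \<open>u + v\<close> and \<open>u - v\<close>, and the parallelogram law bounds the
  result.\<close>

lemma symmetric_norm_le:
  fixes D :: "'h::real_inner \<Rightarrow> 'h"
  assumes lin: "linear D" and sym: "\<And>u v. D u \<bullet> v = u \<bullet> D v"
    and le: "\<And>u. \<bar>D u \<bullet> u\<bar> \<le> b * (norm u)\<^sup>2"
  shows "norm (D u) \<le> b * norm u"
proof (cases "u = 0 \<or> D u = 0")
  case True
  have "0 \<le> b * (norm u)\<^sup>2" using le[of u] by linarith
  then show ?thesis using True lin by (cases "u = 0") (auto simp: linear_0 zero_le_mult_iff)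
next
  case False
  \<comment> \<open>The multiple of \<open>D u\<close> that has the norm of \<open>u\<close>:
    pairing with it gives \<open>norm u * norm (D u)\<close>, and both squared norms in the
    parallelogram law agree.\<close>
  define v where "v = (norm u / norm (D u)) *\<^sub>R D u"
  have v: "norm v = norm u" "D u \<bullet> v = norm u * norm (D u)"
    using False by (auto simp: v_def power2_norm_eq_inner[symmetric] power2_eq_square)
  have "4 * (D u \<bullet> v) = D (u + v) \<bullet> (u + v) - D (u - v) \<bullet> (u - v)"
    using sym[of u v] by (simp add: linear_add[OF lin] linear_diff[OF lin] inner_add_left
        inner_add_right inner_diff_left inner_diff_right inner_commute)
  also have "\<dots> \<le> b * (norm (u + v))\<^sup>2 + b * (norm (u - v))\<^sup>2"
    using le[of "u + v"] le[of "u - v"] by linarith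
  also have "\<dots> = b * (2 * (norm u)\<^sup>2 + 2 * (norm v)\<^sup>2)"
    by (simp add: power2_norm_eq_inner inner_add_left inner_add_right inner_diff_left
        inner_diff_right inner_commute algebra_simps)
  finally have "norm u * norm (D u) \<le> norm u * (b * norm u)" using v by (simp add: power2_eq_square mult.left_commute)
  then show ?thesis using False by simp
qed

text \<open>The sum of the squared norms \<open>norm (T e)\<close> over a basis is independent of
  the basis: expand each vector in a second basis, exchange the sums and use symmetry. Two bases
  occur in the result because the operators to be compared are diagonal in different ones.\<close>

lemma op_trace_adjoint:
  fixes T :: "'h::real_inner \<Rightarrow> 'h"
  assumes p: "orthonormal_basis I p" and q: "orthonormal_basis J q"
    and sym: "\<And>u v. T u \<bullet> v = u \<bullet> T v"
  shows "op_trace (adjoint T \<circ> T) = (\<Sum>\<^sub>\<infinity>i\<in>I. \<Sum>\<^sub>\<infinity>k\<in>J. ennreal ((T (q k) \<bullet> p i)\<^sup>2))"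
proof -
  have swap: "(\<Sum>\<^sub>\<infinity>i\<in>A. ennreal ((norm (T (e i)))\<^sup>2)) = (\<Sum>\<^sub>\<infinity>k\<in>B. ennreal ((norm (T (g k)))\<^sup>2))"
    if "orthonormal_basis A e" "orthonormal_basis B g"
    for A :: "'c set" and e :: "'c \<Rightarrow> 'h" and B :: "'d set" and g :: "'d \<Rightarrow> 'h"
  proof -
    have "(\<Sum>\<^sub>\<infinity>i\<in>A. ennreal ((norm (T (e i)))\<^sup>2)) = (\<Sum>\<^sub>\<infinity>i\<in>A. \<Sum>\<^sub>\<infinity>k\<in>B. ennreal ((T (e i) \<bullet> g k)\<^sup>2))"
      by (simp add: infsum_Parseval[OF that(2)])
    also have "\<dots> = (\<Sum>\<^sub>\<infinity>k\<in>B. \<Sum>\<^sub>\<infinity>i\<in>A. ennreal ((T (g k) \<bullet> e i)\<^sup>2))"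
      by (subst infsum_ennreal_swap) (simp only: sym[of "e _"] inner_commute[of "e _"])
    also have "\<dots> = (\<Sum>\<^sub>\<infinity>k\<in>B. ennreal ((norm (T (g k)))\<^sup>2))"
      by (simp add: infsum_Parseval[OF that(1)])
    finally show ?thesis .
  qed
  define E where "E = (SOME E :: 'h set. orthonormal_basis E (\<lambda>e. e))"
  have E: "orthonormal_basis E (\<lambda>e. e)"
    unfolding E_def by (rule someI[of _ "p ` I"]) (rule orthonormal_basis_range[OF p])
  \<comment> \<open>\<open>adjoint\<close> is a choice among the maps satisfying the adjoint
    identity, and \<open>T\<close> itself is the only such map.\<close>
  have "adjoint T = T" using sym by (intro adjoint_unique) auto
  then have "op_trace (adjoint T \<circ> T) = (\<Sum>\<^sub>\<infinity>e\<in>E. ennreal ((norm (T e))\<^sup>2))"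
    by (simp add: op_trace_def E_def[symmetric] sym power2_norm_eq_inner)
  also have "\<dots> = (\<Sum>\<^sub>\<infinity>k\<in>J. ennreal ((norm (T (q k)))\<^sup>2))"
    by (rule swap[OF E q])
  also have "\<dots> = (\<Sum>\<^sub>\<infinity>k\<in>J. \<Sum>\<^sub>\<infinity>i\<in>I. ennreal ((T (q k) \<bullet> p i)\<^sup>2))"
    by (simp add: infsum_Parseval[OF p])
  finally show ?thesis by (simp add: infsum_ennreal_swap[of _ I])
qed

text \<open>Expand \<open>T x \<bullet> x\<close> in the eigenbasis and exchange the sums: each
  weight \<open>(x \<bullet> e i)\<^sup>2\<close> sums to 1 over \<open>x\<close>. Non-negativity of
  \<open>c\<close> keeps \<open>ennreal\<close> from cutting off terms.\<close>

lemma op_trace_diagonal_in: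
  fixes T :: "'h::real_inner \<Rightarrow> 'h"
  assumes T: "diagonal_in I e c T" and c: "\<And>i. i \<in> I \<Longrightarrow> 0 \<le> c i"
  shows "op_trace T = (\<Sum>\<^sub>\<infinity>i\<in>I. ennreal (c i))"
proof -
  note ob = diagonal_inD(1)[OF T]
  define E where "E = (SOME E :: 'h set. orthonormal_basis E (\<lambda>e. e))"
  have E: "orthonormal_basis E (\<lambda>e. e)"
    unfolding E_def by (rule someI[of _ "e ` I"]) (rule orthonormal_basis_range[OF ob])
  have "op_trace T = (\<Sum>\<^sub>\<infinity>x\<in>E. \<Sum>\<^sub>\<infinity>i\<in>I. ennreal (c i * (x \<bullet> e i)\<^sup>2))"
    unfolding op_trace_def E_def[symmetric]
    by (intro infsum_cong infsum_ennreal_eq[symmetric] diagonal_in_quadratic[OF T]) (simp add: c)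
  also have "\<dots> = (\<Sum>\<^sub>\<infinity>i\<in>I. \<Sum>\<^sub>\<infinity>x\<in>E. ennreal (c i * (x \<bullet> e i)\<^sup>2))"
    by (rule infsum_ennreal_swap)
  also have "\<dots> = (\<Sum>\<^sub>\<infinity>i\<in>I. ennreal (c i))"
  proof (rule infsum_cong)
    fix i assume i: "i \<in> I"
    show "(\<Sum>\<^sub>\<infinity>x\<in>E. ennreal (c i * (x \<bullet> e i)\<^sup>2)) = ennreal (c i)"
      using has_sum_cmult_right[OF Parseval_norm[OF E, of "e i"], of "c i"] c[OF i] orthonormal_basis_norm[OF ob i]
      by (intro infsum_ennreal_eq) (auto simp: inner_commute)
  qed
  finally show ?thesis .
qed

section \<open>Comparison of Hilbert-Schmidt norms\<close>

lemma hs_norm_le_cmult: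
  assumes c: "0 < c" and le: "op_trace (adjoint S \<circ> S) \<le> ennreal (c\<^sup>2) * op_trace (adjoint T \<circ> T)"
  shows "hs_norm S \<le> ennreal c * hs_norm T"
proof (cases "op_trace (adjoint T \<circ> T)")
  case (real t)
  then have "op_trace (adjoint S \<circ> S) \<le> ennreal (c\<^sup>2 * t)" using le by (simp add: ennreal_mult)
  then obtain s where s: "op_trace (adjoint S \<circ> S) = ennreal s" "0 \<le> s" "s \<le> c\<^sup>2 * t"
    using real by (cases "op_trace (adjoint S \<circ> S)") (auto simp: ennreal_le_iff top_unique)
  have "sqrt s \<le> sqrt (c\<^sup>2 * t)" using s by simp
  also have "\<dots> = c * sqrt t" using c by (simp add: real_sqrt_mult)
  finally show ?thesis
    using s(1,2) real c by (simp add: hs_norm_def ennreal_mult[symmetric] ennreal_le_iff)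
next
  case top
  \<comment> \<open>Strict positivity of \<open>c\<close> matters here, since 0 times infinity is 0
    in \<open>ennreal\<close>.\<close>
  then show ?thesis using c by (simp add: hs_norm_def ennreal_mult_top)
qed

lemma hs_norm_le_sqrt:
  assumes "op_trace (adjoint T \<circ> T) \<le> ennreal r" "0 \<le> r"
  shows "hs_norm T \<le> ennreal (sqrt r)"
  using assms by (cases "op_trace (adjoint T \<circ> T)") (auto simp: hs_norm_def ennreal_le_iff top_unique)

text \<open>In a mixed matrix entry, \<open>S\<close> acts through its coefficient along
  \<open>p i\<close> and \<open>T\<close> through its eigenvector \<open>q k\<close>.\<close>

lemma diagonal_in_diff_inner:
  assumes S: "diagonal_in I p c S" and T: "diagonal_in J q d T" and "i \<in> I" "k \<in> J"
  shows "(S (q k) - T (q k)) \<bullet> p i = (c i - d k) * (q k \<bullet> p i)"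
  using assms by (simp add: inner_diff_left diagonal_inD(2)[OF S] diagonal_in_eigenvector[OF T] left_diff_distrib)

lemma op_trace_adjoint_diff:
  assumes S: "diagonal_in I p c S" and T: "diagonal_in J q d T"
  shows "op_trace (adjoint (\<lambda>u. S u - T u) \<circ> (\<lambda>u. S u - T u)) =
    (\<Sum>\<^sub>\<infinity>i\<in>I. \<Sum>\<^sub>\<infinity>k\<in>J. ennreal ((c i - d k)\<^sup>2 * (q k \<bullet> p i)\<^sup>2))"
proof (subst op_trace_adjoint[OF diagonal_inD(1)[OF S] diagonal_inD(1)[OF T]])
  show "(S u - T u) \<bullet> v = u \<bullet> (S v - T v)" for u v
    by (simp add: inner_diff_left inner_diff_right diagonal_in_symmetric[OF S] diagonal_in_symmetric[OF T])
qed (auto simp: diagonal_in_diff_inner[OF S T] power_mult_distrib intro!: infsum_cong)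

text \<open>Both double sums carry the same weights \<open>(q k \<bullet> p i)\<^sup>2\<close>, so
  comparing the eigenvalue differences for every pair of indices is enough.\<close>

lemma hs_norm_spectral_diff_le:
  assumes S: "diagonal_in I p c S" and T: "diagonal_in J q d T"
    and S': "diagonal_in I p c' S'" and T': "diagonal_in J q d' T'"
    and a: "0 < a" and le: "\<And>i k. i \<in> I \<Longrightarrow> k \<in> J \<Longrightarrow> \<bar>c' i - d' k\<bar> \<le> a * \<bar>c i - d k\<bar>"
  shows "hs_norm (\<lambda>u. S' u - T' u) \<le> ennreal a * hs_norm (\<lambda>u. S u - T u)"
proof (rule hs_norm_le_cmult[OF a])
  have "(c' i - d' k)\<^sup>2 * w \<le> a\<^sup>2 * ((c i - d k)\<^sup>2 * w)" if "i \<in> I" "k \<in> J" "0 \<le> w" for i k w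
  proof -
    have "\<bar>c' i - d' k\<bar>\<^sup>2 \<le> (a * \<bar>c i - d k\<bar>)\<^sup>2" using le[OF that(1,2)] by (intro power_mono) auto
    then show ?thesis using that(3) by (simp add: power_mult_distrib mult.assoc[symmetric] mult_right_mono)
  qed
  then show "op_trace (adjoint (\<lambda>u. S' u - T' u) \<circ> (\<lambda>u. S' u - T' u))
      \<le> ennreal (a\<^sup>2) * op_trace (adjoint (\<lambda>u. S u - T u) \<circ> (\<lambda>u. S u - T u))"
    unfolding op_trace_adjoint_diff[OF S T] op_trace_adjoint_diff[OF S' T'] infsum_ennreal_cmult[symmetric]
    by (intro infsum_ennreal_mono) (simp add: ennreal_mult''[symmetric] ennreal_leI)
qed

section \<open>Eigenvalues of the shrunk estimator\<close>

text \<open>The dimension count behind the min-max comparison of eigenvalues.\<close>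

lemma exists_unit_vector_orthogonal:
  fixes p :: "'i \<Rightarrow> 'h::real_inner" and q :: "'j \<Rightarrow> 'h"
  assumes p: "orthonormal_basis I p" and q: "orthonormal_basis J q"
    and F: "F \<subseteq> I" "finite F" and A: "A \<subseteq> J" and card: "card F < card A"
  obtains u where "norm u = 1" "\<And>i. i \<in> F \<Longrightarrow> u \<bullet> p i = 0" "\<And>k. k \<in> J - A \<Longrightarrow> u \<bullet> q k = 0"
proof -
  define P where "P u = (\<Sum>i\<in>F. (u \<bullet> p i) *\<^sub>R p i)" for u
  have P: "linear P"
    by (intro linearI) (simp_all add: P_def inner_add_left scaleR_add_left sum.distrib scaleR_sum_right)
  \<comment> \<open>\<open>P\<close> projects onto the span of \<open>p\<close> over
    \<open>F\<close>. Were it injective on the span of \<open>q\<close> over \<open>A\<close>, it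
    would produce \<open>card A\<close> independent vectors in a space spanned by
    \<open>card F\<close> vectors.\<close>
  have "\<exists>u\<in>span (q ` A). P u = 0 \<and> u \<noteq> 0"
  proof (rule ccontr)
    assume "\<not> ?thesis"
    then have inj: "inj_on P (span (q ` A))"
      by (subst linear_inj_on_iff_eq_0[OF P]) auto
    have "independent (q ` A)"
      using orthonormal_basisD[OF q] A
      by (intro pairwise_orthogonal_independent) (fastforce simp: pairwise_def orthogonal_def subset_iff)+
    then have "independent (P ` q ` A)"
      using P inj by (intro linear_independent_injective_image)
    moreover have "P ` q ` A \<subseteq> span (p ` F)"
      by (auto simp: P_def intro!: span_sum span_scale intro: span_base)
    ultimately have "card (P ` q ` A) \<le> card (p ` F)"
      using independent_span_bound[of "p ` F"] F by blast
    moreover have "card (P ` q ` A) = card A"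
      using inj_on_subset[OF inj span_superset] inj_on_subset[OF orthonormal_basis_inj_on[OF q] A]
      by (simp add: card_image)
    ultimately show False using card card_image_le[OF F(2), of p] by linarith
  qed
  then obtain v where v: "v \<in> span (q ` A)" "P v = 0" "v \<noteq> 0" by blast
  have "v \<bullet> p j = 0" if "j \<in> F" for j
  proof -
    have "P v \<bullet> p j = (\<Sum>i\<in>F. if i = j then v \<bullet> p j else 0)"
      unfolding P_def inner_sum_left using p F that
      by (intro sum.cong) (auto simp: orthonormal_basisD subset_iff)
    then show ?thesis using that F v by simp
  qed
  moreover have "v \<bullet> q k = 0" if "k \<in> J - A" for k
    using v(1)
  proof (induction rule: span_induct_alt)
    case (step c x y)
    then show ?case using that A by (auto simp: inner_add_left orthonormal_basisD[OF q] subset_iff split: if_splits)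
  qed simp
  ultimately show thesis using v(3) by (intro that[of "v /\<^sub>R norm v"]) auto
qed

section \<open>Heads and tails of sums over the index set\<close>

lemma infsum_head_le:
  fixes f :: "nat \<Rightarrow> ennreal"
  assumes "I \<subseteq> {1..}" "\<And>i. i \<in> I \<Longrightarrow> f i \<le> C"
  shows "(\<Sum>\<^sub>\<infinity>i\<in>I. if i \<le> \<tau> then f i else 0) \<le> of_nat \<tau> * C"
proof -
  \<comment> \<open>Numbering from 1 leaves at most \<tau> indices in the head; there are fewer when
    \<tau> exceeds the dimension.\<close>
  have sub: "{i\<in>I. i \<le> \<tau>} \<subseteq> {1..\<tau>}" using assms(1) by auto
  then have fin: "finite {i\<in>I. i \<le> \<tau>}" by (rule finite_subset) simp
  have "(\<Sum>\<^sub>\<infinity>i\<in>I. if i \<le> \<tau> then f i else 0) = (\<Sum>\<^sub>\<infinity>i\<in>{i\<in>I. i \<le> \<tau>}. f i)"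
    by (intro infsum_cong_neutral) auto
  also have "\<dots> = (\<Sum>i\<in>{i\<in>I. i \<le> \<tau>}. f i)" using fin by simp
  also have "\<dots> \<le> of_nat (card {i\<in>I. i \<le> \<tau>}) * C"
    using assms(2) by (intro sum_bounded_above) auto
  also have "\<dots> \<le> of_nat \<tau> * C"
    using card_mono[OF _ sub] by (intro mult_right_mono) auto
  finally show ?thesis .
qed

lemma infsum_tail:
  fixes f :: "nat \<Rightarrow> real"
  assumes "f summable_on I" "\<And>i. i \<in> I \<Longrightarrow> 0 \<le> f i"
  shows "(\<Sum>\<^sub>\<infinity>i\<in>I. if \<tau> < i then ennreal (f i) else 0) = ennreal (\<Sum>\<^sub>\<infinity>i\<in>{i\<in>I. \<tau> < i}. f i)"
proof -
  have "(\<Sum>\<^sub>\<infinity>i\<in>I. if \<tau> < i then ennreal (f i) else 0) = (\<Sum>\<^sub>\<infinity>i\<in>{i\<in>I. \<tau> < i}. ennreal (f i))"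
    by (intro infsum_cong_neutral) auto
  also have "\<dots> = ennreal (\<Sum>\<^sub>\<infinity>i\<in>{i\<in>I. \<tau> < i}. f i)"
    using summable_on_subset_banach[OF assms(1), of "{i\<in>I. \<tau> < i}"] assms(2)
    by (intro infsum_ennreal_eq) (auto simp: has_sum_iff)
  finally show ?thesis .
qed

section \<open>The deterministic argument at a fixed sample point\<close>

locale quadratic_perturbation =
  fixes I :: "nat set" and S H :: "'h::{real_inner, banach} \<Rightarrow> 'h"
    and lam mu lam_hat lam_til :: "nat \<Rightarrow> real" and p q :: "nat \<Rightarrow> 'h" and B :: "real \<Rightarrow> real"
  assumes I: "basis_index I"
    and S: "diagonal_in I p lam S" and H: "diagonal_in I q mu H"
    and lam_antimono: "antimono_on I lam" and lam_nonneg: "\<And>i. i \<in> I \<Longrightarrow> 0 \<le> lam i"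
    and lam_hat: "\<And>i. i \<in> I \<Longrightarrow> lam_hat i = max (mu i) 0" and lam_hat_antimono: "antimono_on I lam_hat"
    and lam_til: "\<And>i. i \<in> I \<Longrightarrow> lam_til i = max (lam_hat i - B (lam_hat i)) 0"
    and B_mono: "mono B" and B_half: "\<And>t a. 0 \<le> a \<Longrightarrow> B (t + a) \<le> B t + a / 2"
    and close: "\<And>u. norm u = 1 \<Longrightarrow> \<bar>S u \<bullet> u - H u \<bullet> u\<bar> \<le> B (S u \<bullet> u) \<and>
                             \<bar>S u \<bullet> u - H u \<bullet> u\<bar> \<le> B (H u \<bullet> u)"
begin

lemma p: "orthonormal_basis I p" and q: "orthonormal_basis I q"
  using S H by (simp_all add: diagonal_inD(1))

lemma one_mem: "1 \<in> I"
  using I by (auto simp: basis_index_def)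

lemma index_ge_1: "i \<in> I \<Longrightarrow> 1 \<le> i"
  using I by (auto simp: basis_index_def)

lemma initial_segment: "k \<in> I \<Longrightarrow> {1..k} \<subseteq> I"
  using I by (auto simp: basis_index_def)

lemma lam_le: "i \<in> I \<Longrightarrow> k \<in> I \<Longrightarrow> k \<le> i \<Longrightarrow> lam i \<le> lam k"
  using lam_antimono by (auto simp: monotone_on_def)

lemma lam_le_1: "i \<in> I \<Longrightarrow> lam i \<le> lam 1"
  using lam_le one_mem index_ge_1 by blast

lemma quadratic_nonneg: "0 \<le> S u \<bullet> u"
  using diagonal_in_quadratic_ge[OF S, of u 0] lam_nonneg by simp

lemma quadratic_le_1: "norm u = 1 \<Longrightarrow> S u \<bullet> u \<le> lam 1"
  using diagonal_in_quadratic_le[OF S, of u "lam 1"] lam_le_1 by simp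

lemma close_1: "norm u = 1 \<Longrightarrow> \<bar>S u \<bullet> u - H u \<bullet> u\<bar> \<le> B (lam 1)"
  using close quadratic_le_1 monoD[OF B_mono] order_trans by blast

lemma B_nonneg: "0 \<le> B (lam 1)"
  using close_1[OF orthonormal_basis_norm[OF p one_mem]] by linarith

lemma norm_diff_le: "norm (S u - H u) \<le> B (lam 1) * norm u"
proof (rule symmetric_norm_le)
  have lin: "linear S" "linear H" by (rule diagonal_in_linear[OF S] diagonal_in_linear[OF H])+
  show "linear (\<lambda>u. S u - H u)" using lin by (rule linear_compose_sub)
  show "(S u - H u) \<bullet> v = u \<bullet> (S v - H v)" for u v
    by (simp add: inner_diff_left inner_diff_right diagonal_in_symmetric[OF S] diagonal_in_symmetric[OF H])
  show "\<bar>(S u - H u) \<bullet> u\<bar> \<le> B (lam 1) * (norm u)\<^sup>2" for u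
  proof (cases "u = 0")
    case False
    let ?v = "u /\<^sub>R norm u"
    \<comment> \<open>Both quadratic forms are homogeneous of degree 2, which reduces the bound to
      unit vectors.\<close>
    have "(S u - H u) \<bullet> u = (norm u)\<^sup>2 * (S ?v \<bullet> ?v - H ?v \<bullet> ?v)"
      using False by (simp add: linear_scale[OF lin(1)] linear_scale[OF lin(2)] inner_diff_left
          power2_eq_square field_simps)
    moreover have "\<bar>S ?v \<bullet> ?v - H ?v \<bullet> ?v\<bar> \<le> B (lam 1)" using False by (intro close_1) simp
    ultimately show ?thesis
      using mult_left_mono[of "\<bar>S ?v \<bullet> ?v - H ?v \<bullet> ?v\<bar>" "B (lam 1)" "(norm u)\<^sup>2"]
      by (simp only: abs_mult abs_power2 mult.commute zero_le_power2)
  qed simp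
qed

lemma lam_til_nonneg: "k \<in> I \<Longrightarrow> 0 \<le> lam_til k"
  by (simp add: lam_til)

lemma quadratic_q: "k \<in> I \<Longrightarrow> H (q k) \<bullet> q k = mu k"
  by (simp add: diagonal_inD(2)[OF H] orthonormal_basisD[OF q])

text \<open>At the unit vector \<open>q k\<close>, \<open>B (mu k)\<close> bounds an absolute value,
  and passing to the positive part can only increase \<open>B\<close>. Consequently subtracting
  \<open>B (lam_hat k)\<close> never enlarges an eigenvalue, and zero stays zero.\<close>

lemma B_lam_hat_nonneg:
  assumes k: "k \<in> I"
  shows "0 \<le> B (lam_hat k)"
proof -
  have "0 \<le> B (mu k)"
    using close[OF orthonormal_basis_norm[OF q k]] quadratic_q[OF k] by auto
  also have "\<dots> \<le> B (lam_hat k)" using k by (intro monoD[OF B_mono]) (simp add: lam_hat)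
  finally show ?thesis .
qed

lemma mu_lam_til:
  assumes k: "k \<in> I"
  shows "\<bar>mu k - lam_til k\<bar> \<le> 3/2 * B (lam 1)"
proof -
  note nq = orthonormal_basis_norm[OF q k]
  have *: "\<bar>S (q k) \<bullet> q k - mu k\<bar> \<le> B (lam 1)" using close_1[OF nq] quadratic_q[OF k] by simp
  show ?thesis
  proof (cases "mu k \<le> 0")
    case True
    then have "lam_hat k = 0" using k by (simp add: lam_hat)
    then have "lam_til k = 0" using k B_lam_hat_nonneg[OF k] by (simp add: lam_til)
    \<comment> \<open>The form of \<open>S\<close> is non-negative, so \<open>- mu k\<close> is at
      most the gap between the two forms at \<open>q k\<close>.\<close>
    then show ?thesis using * True quadratic_nonneg[of "q k"] B_nonneg by simp
  next
    case False
    then have hat: "lam_hat k = mu k" using k by (simp add: lam_hat)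
    \<comment> \<open>This is the source of the factor \<open>3/2\<close>: \<open>mu k\<close>
      exceeds \<open>lam 1\<close> by at most \<open>B (lam 1)\<close>, and over that distance
      \<open>B\<close> grows by at most half of it.\<close>
    have "B (mu k) \<le> B (lam 1 + B (lam 1))"
      using * quadratic_le_1[OF nq] by (intro monoD[OF B_mono]) linarith
    also have "\<dots> \<le> 3/2 * B (lam 1)" using B_half[OF B_nonneg, of "lam 1"] by simp
    finally have "B (mu k) \<le> 3/2 * B (lam 1)" .
    \<comment> \<open>Either the shrunk eigenvalue is 0 and the difference \<open>mu k\<close> is at
      most \<open>B (mu k)\<close>, or the difference equals \<open>B (mu k)\<close>.\<close>
    then show ?thesis using k False B_lam_hat_nonneg[OF k]
      by (cases "mu k \<le> B (mu k)") (simp_all add: lam_til hat)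
  qed
qed

text \<open>
  On the span of \<open>q 1, \<dots>, q k\<close> the form of \<open>H\<close> is at least \<open>lam_hat k\<close>, and that span contains a unit
  vector on which the form of \<open>S\<close> is at most \<open>lam k\<close>; moreover \<open>t - B t\<close> is non-decreasing in \<open>t\<close>.
\<close>

lemma lam_til_le:
  assumes k: "k \<in> I"
  shows "lam_til k \<le> lam k"
proof (cases "lam_hat k = 0")
  case True
  then show ?thesis using B_lam_hat_nonneg[OF k] lam_nonneg[OF k] k by (simp add: lam_til)
next
  case False
  then have pos: "0 < lam_hat k" using k by (simp add: lam_hat)
  \<comment> \<open>There are \<open>k - 1\<close> orthogonality conditions on a space of dimension
    \<open>k\<close>.\<close>
  obtain u where u: "norm u = 1" "\<And>i. i \<in> {1..<k} \<Longrightarrow> u \<bullet> p i = 0" "\<And>j. j \<in> I - {1..k} \<Longrightarrow> u \<bullet> q j = 0"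
  proof (rule exists_unit_vector_orthogonal[OF p q])
    show "{1..<k} \<subseteq> I" "{1..k} \<subseteq> I" using initial_segment[OF k] by auto
    show "card {1..<k} < card {1..k}" using index_ge_1[OF k] by simp
  qed simp_all
  have "lam_hat k * (norm u)\<^sup>2 \<le> H u \<bullet> u"
  proof (rule diagonal_in_quadratic_ge[OF H])
    fix j assume j: "j \<in> I" "u \<bullet> q j \<noteq> 0"
    then have "lam_hat k \<le> lam_hat j"
      using u(3) lam_hat_antimono k by (auto simp: monotone_on_def)
    \<comment> \<open>Positivity of \<open>lam_hat k\<close> makes \<open>lam_hat j\<close>
      positive, hence equal to \<open>mu j\<close>; this is why the zero case is treated
      separately.\<close>
    then show "lam_hat k \<le> mu j" using j pos by (simp add: lam_hat)
  qed
  then have Hu: "lam_hat k \<le> H u \<bullet> u" using u(1) by simp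
  have "S u \<bullet> u \<le> lam k * (norm u)\<^sup>2"
  proof (rule diagonal_in_quadratic_le[OF S])
    fix i assume "i \<in> I" "u \<bullet> p i \<noteq> 0"
    then show "lam i \<le> lam k" using u(2)[of i] index_ge_1[of i] k by (intro lam_le) force+
  qed
  then have Su: "S u \<bullet> u \<le> lam k" using u(1) by simp
  \<comment> \<open>The inequality with \<open>B\<close> taken at the form of the estimator is the
    one that enters.\<close>
  have "H u \<bullet> u - B (H u \<bullet> u) \<le> S u \<bullet> u" using close[OF u(1)] by linarith
  moreover have "B (H u \<bullet> u) \<le> B (lam_hat k) + (H u \<bullet> u - lam_hat k) / 2"
    using B_half[of "H u \<bullet> u - lam_hat k" "lam_hat k"] Hu by simp
  ultimately have "lam_hat k - B (lam_hat k) \<le> lam k" using Hu Su by argo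
  then show ?thesis using k lam_nonneg[OF k] by (simp add: lam_til)
qed

lemma lam_til_le_1: "k \<in> I \<Longrightarrow> lam_til k \<le> lam 1"
  using lam_til_le lam_le_1 order_trans by blast

context
  fixes St :: "'h \<Rightarrow> 'h"
  assumes St: "diagonal_in I q lam_til St"
begin

lemma norm_diff_shrunk_le: "norm (S u - St u) \<le> 5/2 * B (lam 1) * norm u"
proof -
  have "norm (H u - St u) \<le> 3/2 * B (lam 1) * norm u"
    by (rule diagonal_in_norm_le[OF diagonal_in_diff[OF H St] mu_lam_til])
      (use B_nonneg in simp_all)
  then show ?thesis
    using norm_diff_le[of u] norm_triangle_ineq[of "S u - H u" "H u - St u"] by (simp add: algebra_simps)
qed

lemma op_trace_diff_shrunk_le:
  assumes summ: "lam summable_on I"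
  shows "op_trace (adjoint (\<lambda>u. S u - St u) \<circ> (\<lambda>u. S u - St u)) \<le>
    ennreal (13 * real \<tau> * (B (lam 1))\<^sup>2 + 2 * (\<Sum>\<^sub>\<infinity>i\<in>{i\<in>I. \<tau> < i}. (lam i)\<^sup>2))"
proof -
  define R where "R = (\<Sum>\<^sub>\<infinity>i\<in>{i\<in>I. \<tau> < i}. (lam i)\<^sup>2)"
  define C where "C = (5/2 * B (lam 1))\<^sup>2"
  define w where "w i k = (q k \<bullet> p i)\<^sup>2" for i k
  define g where "g i k = ennreal ((lam i - lam_til k)\<^sup>2 * w i k)" for i k
  have R: "0 \<le> R" unfolding R_def by (intro infsum_nonneg) simp
  \<comment> \<open>The eigenvalues are bounded by \<open>lam 1\<close>, so summability passes to
    their squares.\<close>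
  have "(lam i)\<^sup>2 \<le> lam 1 * lam i" if "i \<in> I" for i
    using lam_le_1[OF that] lam_nonneg[OF that] by (simp add: power2_eq_square mult_right_mono)
  then have lam_sq: "(\<lambda>i. (lam i)\<^sup>2) summable_on I"
    by (rule summable_on_comparison_test[OF summable_on_cmult_right[OF summ]]) simp_all
  have I1: "I \<subseteq> {1..}" using index_ge_1 by auto
  \<comment> \<open>By Parseval in each basis, the weights \<open>w\<close> form a doubly stochastic
    matrix.\<close>
  have w_row: "(\<Sum>\<^sub>\<infinity>k\<in>I. ennreal (w i k)) = 1" if "i \<in> I" for i
    using infsum_Parseval[OF q, of "p i"] orthonormal_basis_norm[OF p that]
    by (simp add: w_def inner_commute)
  have w_col: "(\<Sum>\<^sub>\<infinity>i\<in>I. ennreal (w i k)) = 1" if "k \<in> I" for k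
    using infsum_Parseval[OF p, of "q k"] orthonormal_basis_norm[OF q that] by (simp add: w_def)
  have normC: "ennreal ((norm (S u - St u))\<^sup>2) \<le> ennreal C" if "norm u = 1" for u
    using power_mono[OF norm_diff_shrunk_le[of u], of 2] that by (intro ennreal_leI) (simp add: C_def)
  \<comment> \<open>A row of \<open>g\<close> sums to the squared norm of the difference operator at
    \<open>p i\<close>, and a column to that at \<open>q k\<close>.\<close>
  have row: "(\<Sum>\<^sub>\<infinity>k\<in>I. g i k) \<le> ennreal C" if "i \<in> I" for i
  proof -
    have "(\<Sum>\<^sub>\<infinity>k\<in>I. g i k) = (\<Sum>\<^sub>\<infinity>k\<in>I. ennreal (((S (p i) - St (p i)) \<bullet> q k)\<^sup>2))"
      using that by (intro infsum_cong)
        (simp add: g_def w_def inner_diff_left diagonal_inD(2)[OF St] diagonal_in_eigenvector[OF S]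
          power_mult_distrib[symmetric] inner_commute[of "p i"] left_diff_distrib)
    then show ?thesis using normC[OF orthonormal_basis_norm[OF p that]] by (simp add: infsum_Parseval[OF q])
  qed
  have col: "(\<Sum>\<^sub>\<infinity>i\<in>I. g i k) \<le> ennreal C" if "k \<in> I" for k
  proof -
    have "(\<Sum>\<^sub>\<infinity>i\<in>I. g i k) = (\<Sum>\<^sub>\<infinity>i\<in>I. ennreal (((S (q k) - St (q k)) \<bullet> p i)\<^sup>2))"
      using that by (intro infsum_cong) (simp add: g_def w_def diagonal_in_diff_inner[OF S St] power_mult_distrib)
    then show ?thesis using normC[OF orthonormal_basis_norm[OF q that]] by (simp add: infsum_Parseval[OF p])
  qed
  \<comment> \<open>Entries with both indices at most \<tau> are counted twice, which is harmless
    for an upper bound. The tail terms appear only as majorants of the block where both indices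
    exceed \<tau>, but are kept for all other indices so that the weights sum to 1.\<close>
  have le: "g i k \<le> (if i \<le> \<tau> then g i k else 0) + (if k \<le> \<tau> then g i k else 0)
      + (if \<tau> < i then ennreal ((lam i)\<^sup>2) * ennreal (w i k) else 0)
      + (if \<tau> < k then ennreal ((lam k)\<^sup>2) * ennreal (w i k) else 0)" if "i \<in> I" "k \<in> I" for i k
  proof (cases "\<tau> < i \<and> \<tau> < k")
    case True
    \<comment> \<open>Non-negative eigenvalues allow the cross term of the square to be
      dropped.\<close>
    have "0 \<le> lam i * lam_til k" "(lam_til k)\<^sup>2 \<le> (lam k)\<^sup>2"
      using that lam_nonneg lam_til_nonneg lam_til_le by (auto intro: power_mono)
    then have "(lam i - lam_til k)\<^sup>2 \<le> (lam i)\<^sup>2 + (lam k)\<^sup>2" by (simp add: power2_diff)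
    then have "(lam i - lam_til k)\<^sup>2 * w i k \<le> ((lam i)\<^sup>2 + (lam k)\<^sup>2) * w i k"
      by (intro mult_right_mono) (auto simp: w_def)
    then have "g i k \<le> ennreal ((lam i)\<^sup>2 * w i k + (lam k)\<^sup>2 * w i k)"
      unfolding g_def by (intro ennreal_leI) (simp add: distrib_right)
    then show ?thesis using True by (simp add: ennreal_mult w_def)
  next
    case False
    then show ?thesis by (cases "i \<le> \<tau>") (auto simp: add.assoc intro: add_increasing2)
  qed
  have "(\<Sum>\<^sub>\<infinity>i\<in>I. \<Sum>\<^sub>\<infinity>k\<in>I. g i k) \<le> (\<Sum>\<^sub>\<infinity>i\<in>I. \<Sum>\<^sub>\<infinity>k\<in>I.
      (if i \<le> \<tau> then g i k else 0) + (if k \<le> \<tau> then g i k else 0)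
      + (if \<tau> < i then ennreal ((lam i)\<^sup>2) * ennreal (w i k) else 0)
      + (if \<tau> < k then ennreal ((lam k)\<^sup>2) * ennreal (w i k) else 0))"
    by (intro infsum_ennreal_mono le)
  also have "\<dots> = (\<Sum>\<^sub>\<infinity>i\<in>I. \<Sum>\<^sub>\<infinity>k\<in>I. if i \<le> \<tau> then g i k else 0) + (\<Sum>\<^sub>\<infinity>i\<in>I. \<Sum>\<^sub>\<infinity>k\<in>I. if k \<le> \<tau> then g i k else 0)
      + (\<Sum>\<^sub>\<infinity>i\<in>I. \<Sum>\<^sub>\<infinity>k\<in>I. if \<tau> < i then ennreal ((lam i)\<^sup>2) * ennreal (w i k) else 0)
      + (\<Sum>\<^sub>\<infinity>i\<in>I. \<Sum>\<^sub>\<infinity>k\<in>I. if \<tau> < k then ennreal ((lam k)\<^sup>2) * ennreal (w i k) else 0)"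
    by (simp only: infsum_ennreal_add)
  also have "\<dots> \<le> of_nat \<tau> * ennreal C + of_nat \<tau> * ennreal C + ennreal R + ennreal R"
  proof (intro add_mono)
    have "(\<Sum>\<^sub>\<infinity>i\<in>I. \<Sum>\<^sub>\<infinity>k\<in>I. if i \<le> \<tau> then g i k else 0) = (\<Sum>\<^sub>\<infinity>i\<in>I. if i \<le> \<tau> then \<Sum>\<^sub>\<infinity>k\<in>I. g i k else 0)"
      by (intro infsum_cong) simp
    then show "(\<Sum>\<^sub>\<infinity>i\<in>I. \<Sum>\<^sub>\<infinity>k\<in>I. if i \<le> \<tau> then g i k else 0) \<le> of_nat \<tau> * ennreal C"
      using infsum_head_le[OF I1 row] by simp
    have "(\<Sum>\<^sub>\<infinity>i\<in>I. \<Sum>\<^sub>\<infinity>k\<in>I. if k \<le> \<tau> then g i k else 0) = (\<Sum>\<^sub>\<infinity>k\<in>I. if k \<le> \<tau> then \<Sum>\<^sub>\<infinity>i\<in>I. g i k else 0)"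
      by (subst infsum_ennreal_swap) (intro infsum_cong, simp)
    then show "(\<Sum>\<^sub>\<infinity>i\<in>I. \<Sum>\<^sub>\<infinity>k\<in>I. if k \<le> \<tau> then g i k else 0) \<le> of_nat \<tau> * ennreal C"
      using infsum_head_le[OF I1 col] by simp
    have tail: "(\<Sum>\<^sub>\<infinity>i\<in>I. if \<tau> < i then ennreal ((lam i)\<^sup>2) else 0) = ennreal R"
      unfolding R_def by (rule infsum_tail[OF lam_sq]) simp
    have "(\<Sum>\<^sub>\<infinity>k\<in>I. if \<tau> < i then ennreal ((lam i)\<^sup>2) * ennreal (w i k) else 0) =
        (if \<tau> < i then ennreal ((lam i)\<^sup>2) else 0)" if "i \<in> I" for i
      using that by (simp add: infsum_ennreal_cmult w_row)
    then show "(\<Sum>\<^sub>\<infinity>i\<in>I. \<Sum>\<^sub>\<infinity>k\<in>I. if \<tau> < i then ennreal ((lam i)\<^sup>2) * ennreal (w i k) else 0) \<le> ennreal R"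
      using tail by (simp cong: infsum_cong)
    have "(\<Sum>\<^sub>\<infinity>i\<in>I. if \<tau> < k then ennreal ((lam k)\<^sup>2) * ennreal (w i k) else 0) =
        (if \<tau> < k then ennreal ((lam k)\<^sup>2) else 0)" if "k \<in> I" for k
      using that by (simp add: infsum_ennreal_cmult w_col)
    then show "(\<Sum>\<^sub>\<infinity>i\<in>I. \<Sum>\<^sub>\<infinity>k\<in>I. if \<tau> < k then ennreal ((lam k)\<^sup>2) * ennreal (w i k) else 0) \<le> ennreal R"
      using tail by (subst infsum_ennreal_swap) (simp cong: infsum_cong)
  qed
  also have "\<dots> = ennreal (2 * (real \<tau> * C) + 2 * R)"
    using R by (simp add: C_def ennreal_of_nat_eq_real_of_nat ennreal_mult'[symmetric] ennreal_plus[symmetric] del: ennreal_plus)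
  also have "\<dots> \<le> ennreal (13 * real \<tau> * (B (lam 1))\<^sup>2 + 2 * R)"
    by (intro ennreal_leI) (simp add: C_def power_mult_distrib power_divide)
  finally show ?thesis
    by (simp add: op_trace_adjoint_diff[OF S St] g_def w_def R_def)
qed

end

end

section \<open>Covariance operators and Lipschitz functions\<close>

text \<open>Inner products pass through the Bochner integral, and the resulting scalar integrand is
  symmetric in \<open>u\<close> and \<open>v\<close>.\<close>

lemma covariance_op_symmetric:
  fixes X :: "'w \<Rightarrow> 'h::{real_inner, banach, second_countable_topology}"
  assumes "\<And>u. integrable M (covariance_integrand M X u)"
  shows "covariance_op M X u \<bullet> v = u \<bullet> covariance_op M X v"
proof -
  have "covariance_op M X u \<bullet> v = (\<integral>\<omega>. covariance_integrand M X u \<omega> \<bullet> v \<partial>M)"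
    using assms by (simp add: covariance_op_def)
  also have "\<dots> = (\<integral>\<omega>. u \<bullet> covariance_integrand M X v \<omega> \<partial>M)"
    by (intro Bochner_Integration.integral_cong refl) (simp add: covariance_integrand_def inner_commute)
  also have "\<dots> = u \<bullet> covariance_op M X v"
    using assms by (simp add: covariance_op_def)
  finally show ?thesis .
qed

text \<open>Gives boundedness of \<open>f\<close> on a bounded spectrum, as required for the series
  defining the spectral operators to converge.\<close>

lemma lipschitz_abs_le:
  fixes f :: "real \<Rightarrow> real"
  assumes "K-lipschitz_on UNIV f" "\<bar>x\<bar> \<le> r"
  shows "\<bar>f x\<bar> \<le> \<bar>f 0\<bar> + K * r"
proof -
  have "\<bar>f x - f 0\<bar> \<le> K * \<bar>x\<bar>" using lipschitz_onD[OF assms(1), of x 0] by (simp add: dist_real_def)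
  also have "\<dots> \<le> K * r" using assms by (intro mult_left_mono lipschitz_on_nonneg)
  finally show ?thesis by linarith
qed

theorem proposition3p3:
  fixes M :: "'w measure"
    and X :: "'w \<Rightarrow> 'h::{real_inner, banach, second_countable_topology}"
    and Y :: "nat \<Rightarrow> 'w \<Rightarrow> 'h"
    and n :: nat
    and est :: "(nat \<Rightarrow> 'h) \<Rightarrow> 'h \<Rightarrow> 'h"
    and Sigma_X :: "'h \<Rightarrow> 'h"
    and Sigma_hat Sigma_til :: "'w \<Rightarrow> 'h \<Rightarrow> 'h"
    and I :: "nat set"
    and lam :: "nat \<Rightarrow> real"
    and p :: "nat \<Rightarrow> 'h"
    and mu lam_hat lam_til :: "'w \<Rightarrow> nat \<Rightarrow> real"
    and q :: "'w \<Rightarrow> nat \<Rightarrow> 'h"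
    and B :: "real \<Rightarrow> real"
    and \<epsilon> :: real
  assumes "prob_space M"
    and "X \<in> borel_measurable M"
    and "has_finite_trace_covariance M X"
    and "Sigma_X = covariance_op M X"
    and "basis_index I"
    \<comment> \<open>spectral decomposition of the covariance\<close>
    and "eigenbasis Sigma_X I lam p"
    and "antimono_on I lam"
    and "\<forall>i\<in>I. lam i \<ge> 0"
    \<comment> \<open>the estimator, a random symmetric operator\<close>
    and "iid_sample M X n Y"
    and "\<forall>u. (\<lambda>x. est x u) \<in> borel_measurable (Pi\<^sub>M {1..n} (\<lambda>_. borel))"
    and "\<forall>\<omega>\<in>space M. Sigma_hat \<omega> = est (\<lambda>k\<in>{1..n}. Y k \<omega>)"
    and "\<forall>\<omega>\<in>space M. linear (Sigma_hat \<omega>)"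
    and "\<forall>\<omega>\<in>space M. \<forall>u v. Sigma_hat \<omega> u \<bullet> v = u \<bullet> Sigma_hat \<omega> v"
    \<comment> \<open>its spectral decomposition; the \<open>lam_hat\<close> are the eigenvalues of its positive part\<close>
    and "\<forall>\<omega>\<in>space M. eigenbasis (Sigma_hat \<omega>) I (mu \<omega>) (q \<omega>)"
    and "\<forall>\<omega>\<in>space M. \<forall>i\<in>I. lam_hat \<omega> i = max (mu \<omega> i) 0"
    and "\<forall>\<omega>\<in>space M. antimono_on I (lam_hat \<omega>)"
    and "mono B"
    and "\<forall>t a. a \<ge> 0 \<longrightarrow> B (t + a) \<le> B t + a / 2"
    and "0 < \<epsilon>" and "\<epsilon> < 1"
    and "with_prob_at_least M (1 - \<epsilon>) (\<lambda>\<omega>. \<forall>u. norm u = 1 \<longrightarrow>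
           \<bar>Sigma_X u \<bullet> u - Sigma_hat \<omega> u \<bullet> u\<bar> \<le> B (Sigma_X u \<bullet> u) \<and>
           \<bar>Sigma_X u \<bullet> u - Sigma_hat \<omega> u \<bullet> u\<bar> \<le> B (Sigma_hat \<omega> u \<bullet> u))"
    and "\<forall>\<omega>\<in>space M. \<forall>i\<in>I. lam_til \<omega> i = max (lam_hat \<omega> i - B (lam_hat \<omega> i)) 0"
    and "\<forall>\<omega>\<in>space M. Sigma_til \<omega> = spectral_op I (lam_til \<omega>) (q \<omega>)"
  shows "with_prob_at_least M (1 - \<epsilon>) (\<lambda>\<omega>. \<forall>L>0. \<forall>f. (1 / L)-lipschitz_on UNIV f \<longrightarrow>
           hs_norm (\<lambda>u. spectral_op I (\<lambda>i. f (lam i)) p u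
                        - spectral_op I (\<lambda>i. f (lam_til \<omega> i)) (q \<omega>) u)
             \<le> ennreal (1 / L) * hs_norm (\<lambda>u. Sigma_X u - Sigma_til \<omega> u) \<and>
           ennreal (1 / L) * hs_norm (\<lambda>u. Sigma_X u - Sigma_til \<omega> u)
             \<le> (INF \<tau>\<in>{1::nat..}. ennreal (1 / L *
                  sqrt (13 * real \<tau> * (B (lam 1))\<^sup>2 + 2 * (\<Sum>\<^sub>\<infinity>i\<in>{i\<in>I. \<tau> < i}. (lam i)\<^sup>2)))))"
proof -
  note cov = assms(3,4) and S_eig = assms(6) and sym_hat = assms(13) and H_eig = assms(14)
  have int: "integrable M (covariance_integrand M X u)" for u
    using cov(1) by (simp add: has_finite_trace_covariance_def)
  have S: "diagonal_in I p lam Sigma_X"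
    using S_eig by (rule eigenbasis_diagonal_in) (simp add: cov(2) covariance_op_symmetric[OF int])
  \<comment> \<open>The finite trace of the covariance is read off in its eigenbasis.\<close>
  have lam_summable: "lam summable_on I"
  proof (rule summable_on_of_infsum_ennreal)
    show "(\<Sum>\<^sub>\<infinity>i\<in>I. ennreal (lam i)) < \<infinity>"
      using cov op_trace_diagonal_in[OF S] assms(8) by (simp add: has_finite_trace_covariance_def)
  qed (use assms(8) in auto)
  \<comment> \<open>The event of the assumption also serves for the conclusion; on it, the argument
    holds for all \<open>L\<close> and \<open>f\<close> at once.\<close>
  obtain A where A: "A \<in> sets M" "1 - \<epsilon> \<le> measure M A"
    and close: "\<And>\<omega> u. \<omega> \<in> A \<Longrightarrow> norm u = 1 \<Longrightarrow>
       \<bar>Sigma_X u \<bullet> u - Sigma_hat \<omega> u \<bullet> u\<bar> \<le> B (Sigma_X u \<bullet> u) \<and>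
       \<bar>Sigma_X u \<bullet> u - Sigma_hat \<omega> u \<bullet> u\<bar> \<le> B (Sigma_hat \<omega> u \<bullet> u)"
    using assms(21) unfolding with_prob_at_least_def by metis
  show ?thesis
    unfolding with_prob_at_least_def
  proof (intro bexI[OF _ A(1)] conjI A(2) ballI allI impI)
    fix \<omega> L and f :: "real \<Rightarrow> real"
    assume \<omega>: "\<omega> \<in> A" and L: "0 < L" and f: "(1 / L)-lipschitz_on UNIV f"
    have \<omega>M: "\<omega> \<in> space M" using \<omega> A(1) sets.sets_into_space by auto
    have H: "diagonal_in I (q \<omega>) (mu \<omega>) (Sigma_hat \<omega>)"
      using H_eig sym_hat \<omega>M by (intro eigenbasis_diagonal_in) auto
    interpret quadratic_perturbation I Sigma_X "Sigma_hat \<omega>" lam "mu \<omega>" "lam_hat \<omega>" "lam_til \<omega>" p "q \<omega>" B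
      using assms(5,7,8,15,16,17,18,22) \<omega>M close[OF \<omega>] S H
      by unfold_locales auto
    \<comment> \<open>Both spectra lie between 0 and \<open>lam 1\<close>, so the original and
      shrunk operators, and \<open>f\<close> of them, have bounded coefficients.\<close>
    have lam_abs: "\<bar>lam i\<bar> \<le> lam 1" and til_abs: "\<bar>lam_til \<omega> i\<bar> \<le> lam 1" if "i \<in> I" for i
      using lam_le_1 lam_nonneg lam_til_le_1 lam_til_nonneg that by (metis abs_of_nonneg)+
    have St: "diagonal_in I (q \<omega>) (lam_til \<omega>) (Sigma_til \<omega>)"
      using assms(23) \<omega>M spectral_op_diagonal_in[OF q, OF til_abs] by simp
    have fS: "diagonal_in I p (\<lambda>i. f (lam i)) (spectral_op I (\<lambda>i. f (lam i)) p)"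
      by (rule spectral_op_diagonal_in[OF p, OF lipschitz_abs_le[OF f lam_abs]])
    have fSt: "diagonal_in I (q \<omega>) (\<lambda>i. f (lam_til \<omega> i)) (spectral_op I (\<lambda>i. f (lam_til \<omega> i)) (q \<omega>))"
      by (rule spectral_op_diagonal_in[OF q, OF lipschitz_abs_le[OF f til_abs]])
    show "hs_norm (\<lambda>u. spectral_op I (\<lambda>i. f (lam i)) p u - spectral_op I (\<lambda>i. f (lam_til \<omega> i)) (q \<omega>) u)
        \<le> ennreal (1 / L) * hs_norm (\<lambda>u. Sigma_X u - Sigma_til \<omega> u)"
    proof (rule hs_norm_spectral_diff_le[OF S St fS fSt])
      show "\<bar>f (lam i) - f (lam_til \<omega> k)\<bar> \<le> 1 / L * \<bar>lam i - lam_til \<omega> k\<bar>" for i k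
        using lipschitz_onD[OF f, of "lam i" "lam_til \<omega> k"] by (simp add: dist_real_def)
    qed (use L in simp)
    show "ennreal (1 / L) * hs_norm (\<lambda>u. Sigma_X u - Sigma_til \<omega> u)
        \<le> (INF \<tau>\<in>{1::nat..}. ennreal (1 / L *
             sqrt (13 * real \<tau> * (B (lam 1))\<^sup>2 + 2 * (\<Sum>\<^sub>\<infinity>i\<in>{i\<in>I. \<tau> < i}. (lam i)\<^sup>2))))"
    proof (rule INF_greatest)
      fix \<tau> :: nat
      let ?r = "13 * real \<tau> * (B (lam 1))\<^sup>2 + 2 * (\<Sum>\<^sub>\<infinity>i\<in>{i\<in>I. \<tau> < i}. (lam i)\<^sup>2)"
      have "0 \<le> ?r" by (intro add_nonneg_nonneg mult_nonneg_nonneg infsum_nonneg) auto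
      then have "hs_norm (\<lambda>u. Sigma_X u - Sigma_til \<omega> u) \<le> ennreal (sqrt ?r)"
        by (intro hs_norm_le_sqrt op_trace_diff_shrunk_le[OF St lam_summable])
      then show "ennreal (1 / L) * hs_norm (\<lambda>u. Sigma_X u - Sigma_til \<omega> u) \<le> ennreal (1 / L * sqrt ?r)"
        using L \<open>0 \<le> ?r\<close> by (subst ennreal_mult) (auto intro: mult_left_mono)
    qed
  qed
qed

end
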